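(* Fix integers $r,k$ with $3 \le r \le k$, and let $e$ be an edge of a graph $G$ such that $\chi(G)=k+1$ and $\chi(G-e)=k$. Let $x$ be an endpoint of $e$. Then $G-e$ contains at least $\frac{1}{2}\prod_{i=1}^{r-1}(k-i)$ cycles of length $0 \bmod r$ that contain the vertex $x$.
   Context: $\chi$ denotes chromatic number; $G-e$ is the graph obtained by deleting the edge $e$. Cycles are counted as subgraphs. *)

theory Defs
  imports Complex_Main
begin

text \<open>Finite simple undirected graphs: a vertex set together with a set of two-element
  subsets of it.\<close>

type_synonym 'a graph = "'a set \<times> 'a set set"

abbreviation verts :: "'a graph \<Rightarrow> 'a set" where
  "verts G \<equiv> fst G"

abbreviation edges :: "'a graph \<Rightarrow> 'a set set" where
  "edges G \<equiv> snd G"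

definition simple_graph :: "'a graph \<Rightarrow> bool" where
  "simple_graph G \<longleftrightarrow> finite (verts G) \<and> (\<forall>e\<in>edges G. e \<subseteq> verts G \<and> card e = 2)"

definition delete_edge :: "'a graph \<Rightarrow> 'a set \<Rightarrow> 'a graph" where
  "delete_edge G e = (verts G, edges G - {e})"

definition subgraph :: "'a graph \<Rightarrow> 'a graph \<Rightarrow> bool" where
  "subgraph H G \<longleftrightarrow> verts H \<subseteq> verts G \<and> edges H \<subseteq> edges G"

definition proper_coloring :: "'a graph \<Rightarrow> nat \<Rightarrow> ('a \<Rightarrow> nat) \<Rightarrow> bool" where
  "proper_coloring G k f \<longleftrightarrow>
     (\<forall>v\<in>verts G. f v < k) \<and> (\<forall>u v. {u, v} \<in> edges G \<longrightarrow> f u \<noteq> f v)"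

definition chromatic_number :: "'a graph \<Rightarrow> nat" where
  "chromatic_number G = (LEAST k. \<exists>f. proper_coloring G k f)"

text \<open>Being a cycle is a property of a graph, not of a vertex sequence, so the
  rotations and reversals of \<open>vs\<close> all describe one and the same cycle.\<close>

definition is_cycle :: "'a graph \<Rightarrow> bool" where
  "is_cycle C \<longleftrightarrow> (\<exists>vs. 3 \<le> length vs \<and> distinct vs \<and> verts C = set vs \<and>
     edges C = {{vs ! i, vs ! (Suc i mod length vs)} | i. i < length vs})"

definition cycle_length :: "'a graph \<Rightarrow> nat" where
  "cycle_length C = card (edges C)"

definition cycles :: "'a graph \<Rightarrow> 'a graph set" where
  "cycles G = {C. subgraph C G \<and> is_cycle C}"

end

theory Submission
  imports Defs "HOL-Combinatorics.Cycles"
begin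

text \<open>
  Let \<open>e = {x, y}\<close>. Every proper \<open>k\<close>-coloring of \<open>G - e\<close> gives \<open>x\<close> and \<open>y\<close> the same color. Fix such a
  coloring \<open>f\<close> and an \<open>r\<close>-cycle \<open>\<sigma>\<close> of colors moving \<open>f x\<close>, and orient an edge from \<open>u\<close> to \<open>v\<close> when
  \<open>f v = \<sigma> (f u)\<close>. Applying \<open>\<sigma>\<close> to the colors of a set of vertices closed under out-neighbors
  keeps the coloring proper. If no directed cycle went through \<open>x\<close>, doing so either for the
  vertices reachable from \<open>x\<close> in at least one step, or for these and \<open>x\<close> itself, would give
  \<open>x\<close> and \<open>y\<close> different colors. The directed cycle through \<open>x\<close> has length divisible by \<open>r\<close>, and
  the colors along it spell out \<open>\<sigma>\<close>; as a cycle has only two directions, it arises from at most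
  two of the \<open>(k - 1) \<dots> (k - r + 1)\<close> choices of \<open>\<sigma>\<close>.
\<close>

section \<open>Cycles given by vertex lists\<close>

definition cycle_graph :: "'a list \<Rightarrow> 'a graph" where
  "cycle_graph vs = (set vs, {{vs ! i, vs ! (Suc i mod length vs)} | i. i < length vs})"

lemma is_cycle_iff:
  "is_cycle C \<longleftrightarrow> (\<exists>vs. 3 \<le> length vs \<and> distinct vs \<and> C = cycle_graph vs)"
  by (cases C) (simp add: is_cycle_def cycle_graph_def)

text \<open>The predecessor is described by \<open>Suc j mod length vs = i\<close>, which avoids
  subtraction modulo the length.\<close>

lemma cycle_graph_neighbors:
  assumes "distinct vs" "i < length vs" "{vs ! i, v} \<in> edges (cycle_graph vs)"
  shows "v = vs ! (Suc i mod length vs) \<or> (\<exists>j<length vs. Suc j mod length vs = i \<and> v = vs ! j)"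
proof -
  let ?n = "length vs"
  obtain j where j: "j < ?n" "{vs ! i, v} = {vs ! j, vs ! (Suc j mod ?n)}"
    using assms(3) by (auto simp: cycle_graph_def)
  have "Suc j mod ?n < ?n" using j(1) by (intro mod_less_divisor) auto
  moreover from j(2) consider "vs ! i = vs ! j" "v = vs ! (Suc j mod ?n)"
    | "vs ! i = vs ! (Suc j mod ?n)" "v = vs ! j"
    by (auto simp: doubleton_eq_iff)
  ultimately show ?thesis
    using assms(1,2) j(1) by cases (metis nth_eq_iff_index_eq)+
qed

lemma cycle_length_cycle_graph:
  assumes "distinct vs" "3 \<le> length vs"
  shows "cycle_length (cycle_graph vs) = length vs"
proof -
  let ?n = "length vs"
  have "inj_on (\<lambda>i. {vs ! i, vs ! (Suc i mod ?n)}) {..<?n}"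
  proof (rule inj_onI)
    fix i j
    assume ij: "i \<in> {..<?n}" "j \<in> {..<?n}"
      and eq: "{vs ! i, vs ! (Suc i mod ?n)} = {vs ! j, vs ! (Suc j mod ?n)}"
    have lt: "Suc i mod ?n < ?n" "Suc j mod ?n < ?n" using assms(2) by (auto intro: mod_less_divisor)
    show "i = j"
    proof (rule ccontr)
      assume "i \<noteq> j"
      \<comment> \<open>Equal edges at different indices have their ends swapped, so
        \<open>i\<close> and \<open>j\<close> are each other's cyclic successors; this forces length
        2.\<close>
      then have "vs ! i = vs ! (Suc j mod ?n)" "vs ! j = vs ! (Suc i mod ?n)"
        using eq ij assms(1) by (auto simp: doubleton_eq_iff nth_eq_iff_index_eq)
      then have "i = Suc j mod ?n" "j = Suc i mod ?n"
        using assms(1) ij lt by (metis lessThan_iff nth_eq_iff_index_eq)+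
      moreover have "Suc l mod ?n = (if Suc l = ?n then 0 else Suc l)" if "l < ?n" for l
        using that by (simp add: mod_Suc)
      ultimately show False
        using assms(2) ij by (auto split: if_splits)
    qed
  qed
  then have "card ((\<lambda>i. {vs ! i, vs ! (Suc i mod ?n)}) ` {..<?n}) = ?n"
    by (simp add: card_image)
  moreover have "edges (cycle_graph vs) = (\<lambda>i. {vs ! i, vs ! (Suc i mod ?n)}) ` {..<?n}"
    by (auto simp: cycle_graph_def)
  ultimately show ?thesis by (simp add: cycle_length_def)
qed

text \<open>A start vertex and a direction determine the list: each later vertex is the neighbor of
  the previous one that is not the vertex before that. Hence the strong induction, reaching back two
  indices.\<close>

lemma cycle_graph_inject:
  assumes "distinct vs" "distinct ws" "cycle_graph vs = cycle_graph ws"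
    and "vs ! 0 = ws ! 0" "vs ! 1 = ws ! 1"
  shows "vs = ws"
proof -
  have "set vs = set ws" using assms(3) by (simp add: cycle_graph_def)
  then have len: "length ws = length vs"
    using assms(1,2) by (metis distinct_card)
  have "i < length vs \<longrightarrow> vs ! i = ws ! i" for i
  proof (induction i rule: less_induct)
    case (less i)
    show ?case
    proof (cases "i < 2")
      case True
      then have "i = 0 \<or> i = 1" by auto
      then show ?thesis using assms(4,5) by auto
    next
      case False
      then obtain j where i: "i = Suc (Suc j)"
        by (metis One_nat_def Suc_1 less_Suc_eq_0_disj not0_implies_Suc)
      show ?thesis
      proof
        assume lt: "i < length vs"
        have eq: "vs ! j = ws ! j" "vs ! Suc j = ws ! Suc j"
          using less[of j] less[of "Suc j"] lt i by auto
        have "{ws ! Suc j, ws ! i} \<in> edges (cycle_graph ws)"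
          using lt len i by (auto simp: cycle_graph_def intro!: exI[of _ "Suc j"])
        then have "{vs ! Suc j, ws ! i} \<in> edges (cycle_graph vs)"
          using eq assms(3) by simp
        from cycle_graph_neighbors[OF assms(1) _ this] lt i
        have "ws ! i = vs ! i \<or> (\<exists>l<length vs. Suc l mod length vs = Suc j \<and> ws ! i = vs ! l)"
          by simp
        moreover have "l = j" if "l < length vs" "Suc l mod length vs = Suc j" for l
          using that by (auto simp: mod_Suc split: if_splits)
        moreover have "ws ! i \<noteq> ws ! j"
          using assms(2) lt len i by (simp add: nth_eq_iff_index_eq)
        ultimately show "vs ! i = ws ! i" using eq(1) by metis
      qed
    qed
  qed
  then show ?thesis using len by (simp add: list_eq_iff_nth_eq)
qed

text \<open>The source of the factor 2 in the bound. Finiteness is stated as well, since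
  \<open>card\<close> of an infinite set is 0.\<close>

lemma card_cycle_graph_neighbors:
  assumes "is_cycle C" "x \<in> verts C"
  shows "card {v. {x, v} \<in> edges C} \<le> 2" "finite {v. {x, v} \<in> edges C}"
proof -
  obtain vs where vs: "3 \<le> length vs" "distinct vs" "C = cycle_graph vs"
    using assms(1) by (auto simp: is_cycle_iff)
  let ?n = "length vs"
  obtain i where i: "i < ?n" "x = vs ! i"
    using assms(2) vs(3) by (auto simp: cycle_graph_def in_set_conv_nth)
  \<comment> \<open>The index of the cyclic predecessor of \<open>i\<close>.\<close>
  define p where "p = (if i = 0 then ?n - 1 else i - 1)"
  have "j = p" if "j < ?n" "Suc j mod ?n = i" for j
    using that by (auto simp: p_def mod_Suc split: if_splits)
  then have "{v. {x, v} \<in> edges C} \<subseteq> {vs ! (Suc i mod ?n), vs ! p}"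
    using cycle_graph_neighbors[OF vs(2) i(1)] i(2) vs(3) by fastforce
  moreover have "card {vs ! (Suc i mod ?n), vs ! p} \<le> 2" by (simp add: card_insert_if)
  ultimately show "card {v. {x, v} \<in> edges C} \<le> 2" "finite {v. {x, v} \<in> edges C}"
    by (meson card_mono finite.emptyI finite.insertI finite_subset le_trans)+
qed

section \<open>Directed loops and recoloring\<close>

text \<open>A shortest closed walk through \<open>x\<close> repeats no vertex. Lengths 1 and 2 are
  still possible here.\<close>

lemma trancl_loop_imp_cycle:
  assumes "(x, x) \<in> R\<^sup>+"
  obtains vs where "vs \<noteq> []" "distinct vs" "vs ! 0 = x"
    "\<And>i. i < length vs \<Longrightarrow> (vs ! i, vs ! (Suc i mod length vs)) \<in> R"
proof -
  have "\<exists>n>0. (x, x) \<in> R ^^ n" using assms by (simp add: trancl_power)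
  then obtain n where n: "n > 0" "(x, x) \<in> R ^^ n"
    and least: "\<And>m. 0 < m \<Longrightarrow> m < n \<Longrightarrow> (x, x) \<notin> R ^^ m"
    using exists_least_iff[of "\<lambda>n. n > 0 \<and> (x, x) \<in> R ^^ n"] by blast
  obtain g where g: "g 0 = x" "g n = x" "\<And>i. i < n \<Longrightarrow> (g i, g (Suc i)) \<in> R"
    using n(2) by (auto simp: relpow_fun_conv)
  have walk: "(g i, g (i + d)) \<in> R ^^ d" if "i + d \<le> n" for i d
    unfolding relpow_fun_conv using that g(3) by (intro exI[of _ "\<lambda>j. g (i + j)"]) auto
  have "g i \<noteq> g j" if "i < j" "j < n" for i j
  proof
    assume eq: "g i = g j"
    \<comment> \<open>Cutting out the stretch from \<open>i\<close> to \<open>j\<close> leaves a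
      shorter closed walk, nonempty because \<open>j < n\<close>.\<close>
    have "(x, g i) \<in> R ^^ i" using walk[of 0 i] that g(1) by simp
    moreover have "(g i, x) \<in> R ^^ (n - j)" using walk[of j "n - j"] that g(2) eq by simp
    ultimately have "(x, x) \<in> R ^^ (i + (n - j))" by (auto simp: relpow_add)
    moreover have "0 < i + (n - j)" "i + (n - j) < n" using that by auto
    ultimately show False using least[of "i + (n - j)"] by argo
  qed
  then have "inj_on g {0..<n}" by (intro linorder_inj_onI') auto
  then have "distinct (map g [0..<n])" by (simp add: distinct_map)
  moreover have "(map g [0..<n] ! i, map g [0..<n] ! (Suc i mod n)) \<in> R" if "i < n" for i
    using that g(1,2) g(3)[OF that] by (cases "Suc i = n") auto
  ultimately show ?thesis using n(1) g(1) by (intro that[of "map g [0..<n]"]) auto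
qed

text \<open>Inside \<open>S\<close> injectivity of \<open>\<sigma>\<close> keeps colors apart. An
  edge leaving \<open>S\<close> could become monochromatic only if it were a directed edge out of
  \<open>S\<close>, which \<open>closed\<close> forbids.\<close>

lemma proper_coloring_permute:
  assumes f: "proper_coloring H k f" and \<sigma>: "\<sigma> permutes {..<k}"
    and closed: "\<And>u v. u \<in> S \<Longrightarrow> {u, v} \<in> edges H \<Longrightarrow> f v = \<sigma> (f u) \<Longrightarrow> v \<in> S"
  shows "proper_coloring H k (\<lambda>v. if v \<in> S then \<sigma> (f v) else f v)"
proof -
  have "\<sigma> (f v) < k" if "v \<in> verts H" for v
    using that f permutes_in_image[OF \<sigma>, of "f v"] by (auto simp: proper_coloring_def)
  moreover have "\<sigma> (f u) \<noteq> \<sigma> (f v)" if "{u, v} \<in> edges H" for u v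
    using that f permutes_inj[OF \<sigma>] by (auto simp: proper_coloring_def dest: injD)
  moreover have "\<sigma> (f u) \<noteq> f v" if "{u, v} \<in> edges H" "u \<in> S" "v \<notin> S" for u v
    using closed[of u v] that by auto
  moreover have "f u \<noteq> \<sigma> (f v)" if "{u, v} \<in> edges H" "v \<in> S" "u \<notin> S" for u v
    using closed[of v u] that by (auto simp: insert_commute)
  ultimately show ?thesis
    using f by (auto simp: proper_coloring_def)
qed

lemma directed_loop_exists:
  assumes f: "proper_coloring H k f" and \<sigma>: "\<sigma> permutes {..<k}" "\<sigma> (f x) \<noteq> f x"
    and "x \<noteq> y" and same: "\<And>g. proper_coloring H k g \<Longrightarrow> g x = g y"
  shows "(x, x) \<in> {(u, v). {u, v} \<in> edges H \<and> f v = \<sigma> (f u)}\<^sup>+" (is "_ \<in> ?R\<^sup>+")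
proof (rule ccontr)
  assume nx: "(x, x) \<notin> ?R\<^sup>+"
  have eq: "f x = f y" using same[OF f] .
  \<comment> \<open>By \<open>nx\<close> this recoloring leaves \<open>x\<close> alone, so it must
    leave \<open>y\<close> alone too.\<close>
  have "proper_coloring H k (\<lambda>v. if v \<in> ?R\<^sup>+ `` {x} then \<sigma> (f v) else f v)"
    by (rule proper_coloring_permute[OF f \<sigma>(1)]) (auto intro: trancl_into_trancl)
  from same[OF this] have "(x, y) \<notin> ?R\<^sup>+"
    using nx \<sigma>(2) eq by (auto split: if_splits)
  then have ny: "(x, y) \<notin> ?R\<^sup>*" using \<open>x \<noteq> y\<close> by (auto simp: rtrancl_eq_or_trancl)
  \<comment> \<open>Now \<open>x\<close> is recolored but \<open>y\<close> is not, which separates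
    them.\<close>
  have "proper_coloring H k (\<lambda>v. if v \<in> ?R\<^sup>* `` {x} then \<sigma> (f v) else f v)"
    by (rule proper_coloring_permute[OF f \<sigma>(1)]) (auto intro: rtrancl_into_rtrancl)
  from same[OF this] show False
    using ny \<sigma>(2) eq by auto
qed

lemma cycle_of_list_funpow:
  assumes "distinct cs" "cs \<noteq> []"
  shows "(cycle_of_list cs ^^ n) (cs ! 0) = cs ! (n mod length cs)"
proof -
  have "map (cycle_of_list cs ^^ n) cs ! 0 = rotate n cs ! 0"
    using cyclic_rotation[OF assms(1)] by simp
  then show ?thesis using assms(2) by (simp add: nth_rotate)
qed

text \<open>Along the loop the colors are the iterates of the cyclic permutation at
  \<open>f x\<close>. Returning to \<open>f x\<close> forces \<open>length cs\<close> to divide the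
  number of steps.\<close>

lemma colored_cycle_exists:
  assumes f: "proper_coloring H k f"
    and "x \<noteq> y" and same: "\<And>g. proper_coloring H k g \<Longrightarrow> g x = g y"
    and cs: "distinct cs" "3 \<le> length cs" "set cs \<subseteq> {..<k}" "cs ! 0 = f x"
  obtains vs where "3 \<le> length vs" "length vs mod length cs = 0" "distinct vs" "vs ! 0 = x"
    "edges (cycle_graph vs) \<subseteq> edges H"
    "\<And>i. i < length vs \<Longrightarrow> f (vs ! i) = cs ! (i mod length cs)"
proof -
  let ?\<sigma> = "cycle_of_list cs"
  have ne: "cs \<noteq> []" using cs(2) by auto
  have pow: "(?\<sigma> ^^ n) (f x) = cs ! (n mod length cs)" for n
    using cycle_of_list_funpow[OF cs(1) ne] cs(4) by simp
  have "?\<sigma> permutes {..<k}"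
    using cycle_permutes[of cs] cs(3) by (rule permutes_subset)
  moreover have "cs ! 1 \<noteq> cs ! 0"
    using nth_eq_iff_index_eq[OF cs(1), of 1 0] cs(2) ne by auto
  then have "?\<sigma> (f x) \<noteq> f x"
    using pow[of 1] cs(2,4) by simp
  ultimately have "(x, x) \<in> {(u, v). {u, v} \<in> edges H \<and> f v = ?\<sigma> (f u)}\<^sup>+"
    using directed_loop_exists[OF f _ _ \<open>x \<noteq> y\<close> same] by blast
  then obtain vs where vs: "vs \<noteq> []" "distinct vs" "vs ! 0 = x"
    and step: "\<And>i. i < length vs \<Longrightarrow> {vs ! i, vs ! (Suc i mod length vs)} \<in> edges H"
      "\<And>i. i < length vs \<Longrightarrow> f (vs ! (Suc i mod length vs)) = ?\<sigma> (f (vs ! i))"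
    by (rule trancl_loop_imp_cycle) auto
  let ?n = "length vs"
  \<comment> \<open>The case \<open>i = ?n\<close> is included: there the index wraps to 0 and the
    walk is back at \<open>x\<close>.\<close>
  have color: "f (vs ! (i mod ?n)) = (?\<sigma> ^^ i) (f x)" if "i \<le> ?n" for i
    using that by (induction i) (use vs step(2) in auto)
  have "cs ! (?n mod length cs) = cs ! 0"
    using color[of ?n] pow[of ?n] vs cs(4) by simp
  then have mod0: "?n mod length cs = 0"
    using nth_eq_iff_index_eq[OF cs(1), of "?n mod length cs" 0] ne by simp
  \<comment> \<open>Divisibility also rules out loops with one or two vertices.\<close>
  then have "length cs \<le> ?n" using vs(1) by (auto intro: dvd_imp_le)
  moreover have "f (vs ! i) = cs ! (i mod length cs)" if "i < ?n" for i
    using color[of i] pow[of i] that by simp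
  ultimately show ?thesis
    using cs(2) vs mod0 step(1)
    by (intro that[of vs]) (auto simp: cycle_graph_def)
qed

section \<open>Counting the cycles\<close>

text \<open>The color choices inject into pairs of a cycle and a neighbor of \<open>x\<close> on it;
  the neighbor records the direction.\<close>

lemma cycles_through_vertex_bound:
  assumes H: "simple_graph H" and f: "proper_coloring H k f"
    and x: "x \<in> verts H" and "x \<noteq> y" and same: "\<And>g. proper_coloring H k g \<Longrightarrow> g x = g y"
    and r: "3 \<le> r" "r \<le> k"
  shows "(\<Prod>i = 1..r - 1. k - i) \<le> 2 * card {C \<in> cycles H. cycle_length C mod r = 0 \<and> x \<in> verts C}"
    (is "_ \<le> 2 * card ?Cs")
proof -
  \<comment> \<open>Lists of the colors that follow \<open>f x\<close>: fixing \<open>f x\<close> as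
    the first entry represents each \<open>r\<close>-cycle moving it exactly once.\<close>
  define P where "P = {ps. length ps = r - 1 \<and> distinct ps \<and> set ps \<subseteq> {..<k} - {f x}}"
  have fx: "f x < k" using f x by (auto simp: proper_coloring_def)
  have "card P = \<Prod>{k - 1 - (r - 1) + 1..k - 1}"
    unfolding P_def using fx r by (subst card_lists_distinct_length_eq) auto
  also have "\<dots> = (\<Prod>i = 1..r - 1. k - i)"
    by (rule prod.reindex_bij_witness[of _ "\<lambda>i. k - i" "\<lambda>i. k - i"]) (use r in auto)
  finally have cardP: "card P = (\<Prod>i = 1..r - 1. k - i)" .
  let ?good = "\<lambda>ps vs. 3 \<le> length vs \<and> length vs mod r = 0 \<and> distinct vs \<and> vs ! 0 = x \<and>
    edges (cycle_graph vs) \<subseteq> edges H \<and> (\<forall>i<length vs. f (vs ! i) = (f x # ps) ! (i mod r))"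
  have "\<exists>vs. ?good ps vs" if "ps \<in> P" for ps
  proof -
    have "distinct (f x # ps)" "length (f x # ps) = r" "set (f x # ps) \<subseteq> {..<k}"
      using that r fx by (auto simp: P_def)
    then show ?thesis
      using colored_cycle_exists[OF f \<open>x \<noteq> y\<close> same, of "f x # ps"] r(1) by (metis nth_Cons_0)
  qed
  then obtain W where W: "\<And>ps. ps \<in> P \<Longrightarrow> ?good ps (W ps)" by metis
  define N where "N C = {v. {x, v} \<in> edges C}" for C :: "'a graph"
  have inj: "inj_on (\<lambda>ps. (cycle_graph (W ps), W ps ! 1)) P"
  proof (rule inj_onI)
    fix ps qs
    assume P: "ps \<in> P" "qs \<in> P"
      and "(cycle_graph (W ps), W ps ! 1) = (cycle_graph (W qs), W qs ! 1)"
    then have eq: "W ps = W qs"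
      using W[OF P(1)] W[OF P(2)] by (intro cycle_graph_inject) auto
    \<comment> \<open>The cycle is long enough for its first \<open>r\<close> vertices to show every
      entry of \<open>f x # ps\<close>.\<close>
    have "r \<le> length (W ps)" using W[OF P(1)] by (auto intro: dvd_imp_le)
    then have "(f x # ps) ! i = (f x # qs) ! i" if "i < r" for i
      using W[OF P(1)] W[OF P(2)] eq that by (metis less_le_trans mod_less)
    then have "f x # ps = f x # qs" using P r by (intro nth_equalityI) (auto simp: P_def)
    then show "ps = qs" by simp
  qed
  have into: "(cycle_graph (W ps), W ps ! 1) \<in> (SIGMA C:?Cs. N C)" if "ps \<in> P" for ps
  proof -
    let ?vs = "W ps"
    note w = W[OF that]
    have "v \<in> verts H" if v: "v \<in> set ?vs" for v
    proof -
      obtain i where "i < length ?vs" "v = ?vs ! i" using v by (auto simp: in_set_conv_nth)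
      then have "{v, ?vs ! (Suc i mod length ?vs)} \<in> edges H" using w by (auto simp: cycle_graph_def)
      then show ?thesis using H by (auto simp: simple_graph_def)
    qed
    then have "subgraph (cycle_graph ?vs) H" using w by (auto simp: subgraph_def cycle_graph_def)
    moreover have "?vs ! 0 \<in> set ?vs" using w by (intro nth_mem) auto
    then have "x \<in> verts (cycle_graph ?vs)" using w by (simp add: cycle_graph_def)
    moreover have "{?vs ! 0, ?vs ! (Suc 0 mod length ?vs)} \<in> edges (cycle_graph ?vs)"
      unfolding cycle_graph_def snd_conv using w by (intro CollectI exI[of _ 0]) auto
    then have "?vs ! 1 \<in> N (cycle_graph ?vs)" using w by (simp add: N_def)
    moreover have "is_cycle (cycle_graph ?vs)" using w unfolding is_cycle_iff by blast
    ultimately show ?thesis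
      using w cycle_length_cycle_graph[of ?vs] by (simp add: cycles_def)
  qed
  have "finite (edges H)"
    using H by (auto simp: simple_graph_def intro: finite_subset[of _ "Pow (verts H)"])
  then have "finite (Pow (verts H) \<times> Pow (edges H))" using H by (simp add: simple_graph_def)
  then have fin: "finite ?Cs"
    by (rule rev_finite_subset) (auto simp: cycles_def subgraph_def)
  have N: "card (N C) \<le> 2" "finite (N C)" if "C \<in> ?Cs" for C
    using that card_cycle_graph_neighbors[of C x] by (auto simp: N_def cycles_def)
  have "card P \<le> card (SIGMA C:?Cs. N C)"
    using inj into fin N(2) by (intro card_inj_on_le finite_SigmaI) auto
  also have "\<dots> = (\<Sum>C\<in>?Cs. card (N C))" using fin N(2) by (intro card_SigmaI) auto
  also have "\<dots> \<le> (\<Sum>C\<in>?Cs. 2)" using N(1) by (intro sum_mono)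
  finally show ?thesis using cardP by simp
qed

section \<open>From chromatic numbers to colorings\<close>

text \<open>An injective numbering of the finitely many vertices is a proper coloring, so the
  \<open>LEAST\<close> in the definition is attained.\<close>

lemma proper_coloring_chromatic_number:
  assumes "simple_graph G"
  shows "\<exists>f. proper_coloring G (chromatic_number G) f"
proof -
  obtain f :: "'a \<Rightarrow> nat" and n where f: "f ` verts G = {i. i < n}" "inj_on f (verts G)"
    using assms finite_imp_inj_to_nat_seg[of "verts G"] by (auto simp: simple_graph_def)
  have "f u \<noteq> f v" if "{u, v} \<in> edges G" for u v
  proof -
    have "{u, v} \<subseteq> verts G" "card {u, v} = 2" using assms that by (auto simp: simple_graph_def)
    moreover from this have "u \<noteq> v" by auto
    ultimately show ?thesis using f(2) by (simp add: inj_on_eq_iff)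
  qed
  then have "proper_coloring G n f" using f(1) unfolding proper_coloring_def by blast
  then have "\<exists>k f. proper_coloring G k f" by blast
  then show ?thesis unfolding chromatic_number_def by (rule LeastI_ex)
qed

theorem theorem4:
  fixes G :: "'a graph" and e :: "'a set" and x :: 'a and r k :: nat
  assumes "3 \<le> r" and "r \<le> k"
    and "simple_graph G"
    and "e \<in> edges G"
    and "chromatic_number G = k + 1"
    and "chromatic_number (delete_edge G e) = k"
    and "x \<in> e"
  shows "real (card {C \<in> cycles (delete_edge G e). cycle_length C mod r = 0 \<and> x \<in> verts C})
           \<ge> 1 / 2 * (\<Prod>i = 1..r - 1. real k - real i)"
proof -
  let ?H = "delete_edge G e"
  have H: "simple_graph ?H" using assms(3) by (auto simp: simple_graph_def delete_edge_def)
  have e: "e \<subseteq> verts G" "card e = 2" using assms(3,4) by (auto simp: simple_graph_def)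
  then obtain a b where "e = {a, b}" "a \<noteq> b" by (auto simp: card_2_iff)
  then obtain y where y: "e = {x, y}" "x \<noteq> y" using assms(7) by blast
  have x: "x \<in> verts ?H" using e assms(7) by (auto simp: delete_edge_def)
  obtain f where f: "proper_coloring ?H k f"
    using proper_coloring_chromatic_number[OF H] assms(6) by auto
  have not_G: "\<not> proper_coloring G k g" for g
  proof -
    have "k < (LEAST k. \<exists>f. proper_coloring G k f)"
      using assms(5) by (simp add: chromatic_number_def)
    then show ?thesis by (blast dest: not_less_Least)
  qed
  \<comment> \<open>A coloring of \<open>?H\<close> that separates the ends of \<open>e\<close>
    would color \<open>G\<close> with \<open>k\<close> colors.\<close>
  have same: "g x = g y" if "proper_coloring ?H k g" for g
  proof (rule ccontr)
    assume "g x \<noteq> g y"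
    then have "g u \<noteq> g v" if "{u, v} \<in> edges G" for u v
      using that \<open>proper_coloring ?H k g\<close> y(1)
      by (cases "{u, v} = e") (auto simp: proper_coloring_def delete_edge_def doubleton_eq_iff)
    then have "proper_coloring G k g"
      using that by (simp add: proper_coloring_def delete_edge_def)
    then show False using not_G by blast
  qed
  \<comment> \<open>Natural and real subtraction agree because \<open>i < r \<le> k\<close>.\<close>
  have "(\<Prod>i = 1..r - 1. real k - real i) = real (\<Prod>i = 1..r - 1. k - i)"
    unfolding of_nat_prod using assms(2) by (intro prod.cong) (auto simp: of_nat_diff)
  also have "\<dots> \<le> real (2 * card {C \<in> cycles ?H. cycle_length C mod r = 0 \<and> x \<in> verts C})"
    using cycles_through_vertex_bound[OF H f x y(2) same assms(1,2)] by linarith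
  finally show ?thesis by simp
qed

end
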